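(* Let $\mathbb{F}$ be a field, let $(A;\mathrm{d})$ be an increasingly filtered, graded, differential algebra of finite dimension over $\mathbb{F}$, and let $(E_r^{p,q}(A))_{p,q,r\geq 0}$ denote its associated spectral sequence. Suppose that there are integers $r_0\geq 1$ and $m,n\geq 0$ such that (1) the vector space $E^{p,q}_{r_0}(A)$ vanishes whenever $p>m$ or $q>n$; (2) the vector space $E^{m,n}_{r_0}(A)$ has dimension $1$; (3) for all $0\le p\le m$ and $0\le q\le n$, the bilinear pairing $E^{p,q}_{r_0}(A)\otimes_{\mathbb{F}} E^{m-p,n-q}_{r_0}(A)\rightarrow E^{m,n}_{r_0}(A)$ given by the product is non-degenerate. Then for all $r\geq r_0$: (a) the vector space $E^{p,q}_{r}(A)$ vanishes whenever $p>m$ or $q>n$; (b) the vector space $E^{m,n}_{r}(A)$ has dimension $1$; (c) for all $0\le p\le m$ and $0\le q\le n$, the bilinear pairing $E^{p,q}_{r}(A)\otimes_{\mathbb{F}} E^{m-p,n-q}_{r}(A)\rightarrow E^{m,n}_{r}(A)$ given by the product is non-degenerate.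
   Context: An increasingly filtered, graded, differential algebra of finite dimension over $\mathbb{F}$ is an associative $\mathbb{F}$-algebra $A$ of finite dimension together with: (i) a grading $A=\bigoplus_{q\ge 0}A^q$ such that for $\alpha\in A^q,\alpha'\in A^{q'}$ one has $\alpha\alpha'=(-1)^{qq'}\alpha'\alpha\in A^{q+q'}$; (ii) an increasing filtration $F^0A\subset F^1A\subset\cdots\subset A$ by graded subspaces with $F^pA\,F^{p'}A\subset F^{p+p'}A$, bounded (that is, $F^pA=A$ for $p$ large, and $F^pA=0$ for $p<0$ by convention); (iii) a linear map $\mathrm{d}\colon A\to A$ of degree $1$ with $\mathrm{d}^2=0$, $\mathrm{d}F^pA\subset F^pA$, and $\mathrm{d}(\alpha\alpha')=(\mathrm{d}\alpha)\alpha'+(-1)^q\alpha\,\mathrm{d}\alpha'$ for $\alpha\in A^q$, $\alpha'\in A^{q'}$. Write $F^pA^q=F^pA\cap A^q$. The associated spectral sequence uses the indexing convention $$E^{p,q}_r(A)=\frac{Z^{p,q}_r(A)+F^{p-1}A^q}{\mathrm{d}Z^{p+r-1,q-1}_{r-1}(A)+F^{p-1}A^q},\qquad Z^{p,q}_r(A)=\{\alpha\in F^pA^q \mid \mathrm{d}\alpha\in F^{p-r}A^{q+1}\},\quad Z^{p,q}_{-1}(A)=0.$$ The differential $\mathrm{d}_r$ of the $r$-th page is induced by $\mathrm{d}$ and has bidegree $(-r,+1)$. The product of $A$ induces products $E^{p,q}_r(A)\otimes_{\mathbb{F}}E^{p',q'}_r(A)\to E^{p+p',q+q'}_r(A)$,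 for which $\mathrm{d}_r$ satisfies the (graded) Leibniz rule. *)

theory Defs
  imports "Jordan_Normal_Form.VS_Connect" "HOL-Library.Set_Algebras"
begin

section \<open>Direct sums and quotients of vector spaces\<close>

text \<open>A copy of \<^locale>\<open>vector_space\<close>, without the interpretation at type class
  \<^class>\<open>real_vector\<close> whose instances would shadow the names below.\<close>

locale vector_space_with_quotients = vector_space scale
  for scale :: "'a::field \<Rightarrow> 'b::ab_group_add \<Rightarrow> 'b"
begin

text \<open>\<open>W\<close> is the internal direct sum of the family \<open>V\<close> of subspaces. The witness \<open>c\<close> is the
  family of components of \<open>x\<close>; it has finite support.\<close>

definition is_direct_sum :: "'b set \<Rightarrow> ('i \<Rightarrow> 'b set) \<Rightarrow> bool" where
  "is_direct_sum W V \<longleftrightarrow>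
     subspace W \<and> (\<forall>i. subspace (V i) \<and> V i \<subseteq> W) \<and>
     (\<forall>x\<in>W. \<exists>!c. (\<forall>i. c i \<in> V i) \<and> finite {i. c i \<noteq> 0} \<and> x = (\<Sum>i | c i \<noteq> 0. c i))"

text \<open>The quotient \<open>U / W\<close>, for subspaces \<open>W \<subseteq> U\<close>, as a space of cosets. Adding \<open>W\<close> in the
  scalar multiplication only matters for the scalar \<open>0\<close>. The ring multiplication that
  comes with the record type \<open>module\<close> plays no role for vector spaces.\<close>

definition quotient_space :: "'b set \<Rightarrow> 'b set \<Rightarrow> ('a, 'b set) module" where
  "quotient_space U W =
     \<lparr>carrier = (\<lambda>x. x +o W) ` U, mult = undefined, one = undefined,
      zero = W, add = (+), smult = (\<lambda>a C. scale a ` C + W)\<rparr>"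

lemma coset_plus:
  assumes "subspace W"
  shows "(x +o W) + (y +o W) = (x + y) +o W"
proof -
  have "W + W = W"
    using subspace_add[OF assms] subspace_0[OF assms] by (force simp: set_plus_def)
  then show ?thesis by (simp add: set_plus_rearrange)
qed

lemma coset_scale:
  assumes "subspace W"
  shows "scale a ` (x +o W) + W = scale a x +o W"
proof (rule subset_antisym; rule subsetI)
  fix z assume "z \<in> scale a ` (x +o W) + W"
  then obtain w w' where "w \<in> W" "w' \<in> W" "z = scale a (x + w) + w'"
    by (auto simp: set_plus_def elt_set_plus_def)
  then have "z = scale a x + (scale a w + w')" "scale a w + w' \<in> W"
    using assms by (auto simp: scale_right_distrib add.assoc subspace_add subspace_scale)
  then show "z \<in> scale a x +o W" by (auto simp: elt_set_plus_def)
next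
  fix z assume "z \<in> scale a x +o W"
  then obtain w where "w \<in> W" "z = scale a x + w" by (auto simp: elt_set_plus_def)
  moreover have "x \<in> x +o W" using subspace_0[OF assms] by (force simp: elt_set_plus_def)
  ultimately show "z \<in> scale a ` (x +o W) + W" by (auto simp: set_plus_def)
qed

lemma coset_eq_iff:
  assumes "subspace W"
  shows "x +o W = y +o W \<longleftrightarrow> x - y \<in> W"
proof
  assume eq: "x +o W = y +o W"
  have "x \<in> x +o W" using subspace_0[OF assms] by (force simp: elt_set_plus_def)
  then show "x - y \<in> W" unfolding eq by (auto simp: elt_set_plus_def)
next
  assume d: "x - y \<in> W"
  have "u +o W \<subseteq> v +o W" if "u - v \<in> W" for u v
  proof
    fix z assume "z \<in> u +o W"
    then obtain w where "w \<in> W" "z = u + w" by (auto simp: elt_set_plus_def)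
    then have "z = v + ((u - v) + w)" "(u - v) + w \<in> W"
      using subspace_add[OF assms that] by auto
    then show "z \<in> v +o W" unfolding elt_set_plus_def by blast
  qed
  moreover have "y - x \<in> W" using subspace_neg[OF assms d] by simp
  ultimately show "x +o W = y +o W" using d by blast
qed

lemma vectorspace_quotient_space:
  assumes U: "subspace U" and W: "subspace W"
  shows "vectorspace class_ring (quotient_space U W)"
proof -
  have field: "field (class_ring :: 'a ring)"
    using class_field.field_axioms by simp
  have zero: "0 +o W = W" by simp
  have "abelian_group (quotient_space U W)"
  proof (rule abelian_groupI; (simp add: quotient_space_def)?)
    show "W \<in> (\<lambda>x. x +o W) ` U"
      using subspace_0[OF U] zero by (metis imageI)
  next
    fix C D assume "C \<in> (\<lambda>x. x +o W) ` U" "D \<in> (\<lambda>x. x +o W) ` U"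
    then show "C + D \<in> (\<lambda>x. x +o W) ` U"
      using subspace_add[OF U] by (force simp: coset_plus[OF W])
  next
    fix C D E :: "'b set"
    show "C + D + E = C + (D + E)" by (simp add: add.assoc)
  next
    fix C D :: "'b set"
    show "C + D = D + C" by (simp add: add.commute)
  next
    fix C assume "C \<in> (\<lambda>x. x +o W) ` U"
    then show "W + C = C" using coset_plus[OF W, of 0] by force
  next
    fix C assume "C \<in> (\<lambda>x. x +o W) ` U"
    then obtain x where x: "x \<in> U" "C = x +o W" by auto
    have "(-x +o W) + C = W" using coset_plus[OF W, of "-x" x] x by simp
    then show "\<exists>y\<in>U. (y +o W) + C = W" using subspace_neg[OF U x(1)] by blast
  qed
  moreover have "cring (class_ring :: 'a ring)" using field by (simp add: field_def domain_def)
  ultimately have "module class_ring (quotient_space U W)"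
  proof (intro moduleI, goal_cases)
    case (3 a C)
    then obtain x where "x \<in> U" "C = x +o W" by (auto simp: quotient_space_def)
    then show ?case
      using subspace_scale[OF U] coset_scale[OF W] by (simp add: quotient_space_def)
  next
    case (4 a b C)
    then obtain x where "C = x +o W" by (auto simp: quotient_space_def)
    then show ?case
      by (simp add: quotient_space_def coset_scale[OF W] coset_plus[OF W])
        (simp add: scale_left_distrib)
  next
    case (5 a C D)
    then obtain x y where "C = x +o W" "D = y +o W" by (auto simp: quotient_space_def)
    then show ?case
      by (simp add: quotient_space_def coset_scale[OF W] coset_plus[OF W] scale_right_distrib)
  next
    case (6 a b C)
    then obtain x where "C = x +o W" by (auto simp: quotient_space_def)
    then show ?case
      by (simp add: quotient_space_def coset_scale[OF W])
  next
    case (7 C)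
    then obtain x where "C = x +o W" by (auto simp: quotient_space_def)
    then show ?case
      using coset_scale[OF W, of 1 x] by (simp add: quotient_space_def)
  qed
  then show ?thesis using field by (simp add: vectorspace_def)
qed

end

section \<open>Increasingly filtered, graded, differential algebras\<close>

text \<open>The algebra is the type \<open>'a\<close>; no unit is required. Grading and filtration are indexed by
  the integers and extended by zero to negative indices. The summand \<open>A\<^sup>q\<close> is \<open>G q\<close> and the
  filtration step \<open>F\<^sup>pA\<close> is \<open>F p\<close>.\<close>

locale filtered_dga = vector_space_with_quotients scale
  for scale :: "'f::field \<Rightarrow> 'a::ring \<Rightarrow> 'a" (infixr \<open>*s\<close> 75) +
  fixes G F :: "int \<Rightarrow> 'a set" and d :: "'a \<Rightarrow> 'a"
  assumes scale_mult_left: "(c *s x) * y = c *s (x * y)"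
    and scale_mult_right: "x * (c *s y) = c *s (x * y)"
    and finite_dimensional: "\<exists>B. finite B \<and> span B = UNIV"
    and grading: "is_direct_sum UNIV G"
    and grading_neg: "q < 0 \<Longrightarrow> G q = {0}"
    and grading_mult: "x \<in> G q \<Longrightarrow> y \<in> G q' \<Longrightarrow> x * y \<in> G (q + q')"
    and graded_commute:
      "x \<in> G q \<Longrightarrow> y \<in> G q' \<Longrightarrow> x * y = ((-1) powi (q * q')) *s (y * x)"
    and filtration_graded: "is_direct_sum (F p) (\<lambda>q. F p \<inter> G q)"
    and filtration_mono: "p \<le> p' \<Longrightarrow> F p \<subseteq> F p'"
    and filtration_neg: "p < 0 \<Longrightarrow> F p = {0}"
    and filtration_bounded: "\<exists>P. \<forall>p\<ge>P. F p = UNIV"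
    and filtration_mult: "x \<in> F p \<Longrightarrow> y \<in> F p' \<Longrightarrow> x * y \<in> F (p + p')"
    and d_linear: "Vector_Spaces.linear scale scale d"
    and d_degree: "x \<in> G q \<Longrightarrow> d x \<in> G (q + 1)"
    and d_d: "d (d x) = 0"
    and d_filtration: "x \<in> F p \<Longrightarrow> d x \<in> F p"
    and d_Leibniz: "x \<in> G q \<Longrightarrow> d (x * y) = d x * y + ((-1) powi q) *s (x * d y)"
begin

definition FG :: "int \<Rightarrow> int \<Rightarrow> 'a set" where
  "FG p q = F p \<inter> G q"

definition Z :: "int \<Rightarrow> int \<Rightarrow> int \<Rightarrow> 'a set" where
  "Z r p q = (if r = -1 then {0} else {x \<in> FG p q. d x \<in> FG (p - r) (q + 1)})"

definition E_num :: "int \<Rightarrow> int \<Rightarrow> int \<Rightarrow> 'a set" where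
  "E_num r p q = Z r p q + FG (p - 1) q"

definition E_den :: "int \<Rightarrow> int \<Rightarrow> int \<Rightarrow> 'a set" where
  "E_den r p q = d ` Z (r - 1) (p + r - 1) (q - 1) + FG (p - 1) q"

definition E :: "int \<Rightarrow> int \<Rightarrow> int \<Rightarrow> ('f, 'a set) module" where
  "E r p q = quotient_space (E_num r p q) (E_den r p q)"

text \<open>The induced product \<open>E\<^sub>r\<^sup>p\<^sup>,\<^sup>q \<times> E\<^sub>r\<^sup>p\<^sup>'\<^sup>,\<^sup>q\<^sup>' \<rightarrow> E\<^sub>r\<^sup>p\<^sup>+\<^sup>p\<^sup>'\<^sup>,\<^sup>q\<^sup>+\<^sup>q\<^sup>'\<close>, with \<open>C * D\<close> the set of products of
  elements of the cosets \<open>C\<close> and \<open>D\<close>: it sends the classes of \<open>x\<close> and \<open>y\<close> to the class of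
  \<open>x * y\<close>, see \<open>E_mult_coset\<close> below.\<close>

definition E_mult :: "int \<Rightarrow> int \<Rightarrow> int \<Rightarrow> int \<Rightarrow> int \<Rightarrow> 'a set \<Rightarrow> 'a set \<Rightarrow> 'a set" where
  "E_mult r p q p' q' C D = C * D + E_den r (p + p') (q + q')"

definition E_pairing_nondegenerate :: "int \<Rightarrow> int \<Rightarrow> int \<Rightarrow> int \<Rightarrow> int \<Rightarrow> bool" where
  "E_pairing_nondegenerate r p q p' q' \<longleftrightarrow>
     (\<forall>x\<in>carrier (E r p q).
        (\<forall>y\<in>carrier (E r p' q'). E_mult r p q p' q' x y = \<zero>\<^bsub>E r (p + p') (q + q')\<^esub>)
          \<longrightarrow> x = \<zero>\<^bsub>E r p q\<^esub>) \<and>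
     (\<forall>y\<in>carrier (E r p' q').
        (\<forall>x\<in>carrier (E r p q). E_mult r p q p' q' x y = \<zero>\<^bsub>E r (p + p') (q + q')\<^esub>)
          \<longrightarrow> y = \<zero>\<^bsub>E r p' q'\<^esub>)"

lemma subspace_F: "subspace (F p)" and subspace_G: "subspace (G q)"
  using filtration_graded grading by (auto simp: is_direct_sum_def)

lemma subspace_FG: "subspace (FG p q)"
  unfolding FG_def by (intro subspace_inter subspace_F subspace_G)

lemma d_add: "d (x + y) = d x + d y" and d_scale: "d (c *s x) = c *s d x"
  using d_linear
  by (auto simp: Vector_Spaces.linear_def module_hom_def module_hom_axioms_def)

lemma d_0: "d 0 = 0"
  using d_scale[of 0 0] by simp

lemma subspace_Z: "subspace (Z r p q)"
proof (cases "r = -1")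
  case True
  then show ?thesis by (simp add: Z_def)
next
  case False
  then show ?thesis
    using subspace_FG[of p q] subspace_FG[of "p - r" "q + 1"]
    by (auto simp: Z_def d_add d_scale d_0 subspace_def)
qed

lemma subspace_set_plus: "subspace U \<Longrightarrow> subspace V \<Longrightarrow> subspace (U + V)"
  using subspace_sums[of U V] by (simp add: set_plus_def Bex_def conj_commute)
    (smt (verit, ccfv_SIG) Collect_cong)

lemma subspace_E_num: "subspace (E_num r p q)"
  unfolding E_num_def by (intro subspace_set_plus subspace_Z subspace_FG)

lemma subspace_d_image: "subspace U \<Longrightarrow> subspace (d ` U)"
  unfolding subspace_def
  by (auto simp: image_iff) (metis d_0, metis d_add, metis d_scale)

lemma subspace_E_den: "subspace (E_den r p q)"
  unfolding E_den_def by (intro subspace_set_plus subspace_FG subspace_d_image subspace_Z)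

lemma vectorspace_E: "vectorspace class_ring (E r p q)"
  unfolding E_def by (intro vectorspace_quotient_space subspace_E_num subspace_E_den)

lemma FG_mono: "p \<le> p' \<Longrightarrow> FG p q \<subseteq> FG p' q"
  using filtration_mono by (auto simp: FG_def)

lemma FG_mult: "x \<in> FG p q \<Longrightarrow> y \<in> FG p' q' \<Longrightarrow> x * y \<in> FG (p + p') (q + q')"
  using filtration_mult grading_mult by (auto simp: FG_def)

lemma FG_d: "x \<in> FG p q \<Longrightarrow> d x \<in> FG p (q + 1)"
  using d_filtration d_degree by (auto simp: FG_def)

lemma Z_subset_FG: "Z r p q \<subseteq> FG p q"
  using subspace_0[OF subspace_FG] by (auto simp: Z_def)

lemma E_num_subset_FG: "E_num r p q \<subseteq> FG p q"
  using Z_subset_FG[of r p q] FG_mono[of "p - 1" p q] subspace_add[OF subspace_FG, of _ p q]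
  by (force simp: E_num_def set_plus_def)

lemma FG_subset_E_den: "FG (p - 1) q \<subseteq> E_den r p q"
  using subspace_0[OF subspace_Z] d_0 unfolding E_den_def set_plus_def by force

lemma FG_subset_E_num: "FG (p - 1) q \<subseteq> E_num r p q"
  using subspace_0[OF subspace_Z] unfolding E_num_def set_plus_def by force

lemma Z_subset_E_num: "Z r p q \<subseteq> E_num r p q"
  using subspace_0[OF subspace_FG] unfolding E_num_def set_plus_def by force

lemma d_Z_subset_E_den: "d ` Z (r - 1) (p + r - 1) (q - 1) \<subseteq> E_den r p q"
  using subspace_0[OF subspace_FG] unfolding E_den_def set_plus_def by force

lemma d_Z_subset_Z:
  assumes "r \<ge> 0"
  shows "d ` Z (r - 1) (p + r - 1) (q - 1) \<subseteq> Z r p q"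
  using assms subspace_0[OF subspace_FG] by (auto simp: Z_def d_d d_0)

lemma E_den_subset_E_num: "r \<ge> 0 \<Longrightarrow> E_den r p q \<subseteq> E_num r p q"
  unfolding E_den_def E_num_def by (intro set_plus_mono2 d_Z_subset_Z subset_refl)

lemma Z_mult:
  assumes x: "x \<in> Z r p q" and y: "y \<in> Z r p' q'" and r: "r \<ge> 0"
  shows "x * y \<in> Z r (p + p') (q + q')"
proof -
  have x': "x \<in> FG p q" "d x \<in> FG (p - r) (q + 1)" and y': "y \<in> FG p' q'" "d y \<in> FG (p' - r) (q' + 1)"
    using x y r by (auto simp: Z_def)
  have "d (x * y) = d x * y + ((-1) powi q) *s (x * d y)"
    using x' d_Leibniz by (auto simp: FG_def)
  moreover have "d x * y \<in> FG (p + p' - r) (q + q' + 1)" "x * d y \<in> FG (p + p' - r) (q + q' + 1)"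
    using FG_mult[OF x'(2) y'(1)] FG_mult[OF x'(1) y'(2)] by (simp_all add: algebra_simps)
  ultimately have "d (x * y) \<in> FG (p + p' - r) (q + q' + 1)"
    using subspace_add[OF subspace_FG] subspace_scale[OF subspace_FG] by metis
  then show ?thesis using FG_mult[OF x'(1) y'(1)] r by (simp add: Z_def)
qed

lemma E_num_mult:
  assumes x: "x \<in> E_num r p q" and y: "y \<in> E_num r p' q'" and r: "r \<ge> 0"
  shows "x * y \<in> E_num r (p + p') (q + q')"
proof -
  obtain z f where zf: "z \<in> Z r p q" "f \<in> FG (p - 1) q" "x = z + f"
    using x by (auto simp: E_num_def set_plus_def)
  obtain z' f' where zf': "z' \<in> Z r p' q'" "f' \<in> FG (p' - 1) q'" "y = z' + f'"
    using y by (auto simp: E_num_def set_plus_def)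
  have "z * f' \<in> FG (p + p' - 1) (q + q')" "f * y \<in> FG (p + p' - 1) (q + q')"
    using FG_mult[of z p q f' "p' - 1" q'] FG_mult[of f "p - 1" q y p' q'] zf zf' Z_subset_FG
      E_num_subset_FG y by (fastforce simp: algebra_simps)+
  then have "z * f' + f * y \<in> FG (p + p' - 1) (q + q')"
    by (rule subspace_add[OF subspace_FG])
  then have "z * z' + (z * f' + f * y) \<in> E_num r (p + p') (q + q')"
    using Z_mult[OF zf(1) zf'(1) r] unfolding E_num_def by blast
  then show ?thesis using zf zf' by (simp add: algebra_simps)
qed

lemma E_den_mult:
  assumes r: "r \<ge> 0"
  shows "x \<in> E_den r p q \<Longrightarrow> y \<in> E_num r p' q' \<Longrightarrow> x * y \<in> E_den r (p + p') (q + q')"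
    and "x \<in> E_num r p q \<Longrightarrow> y \<in> E_den r p' q' \<Longrightarrow> x * y \<in> E_den r (p + p') (q + q')"
proof -
  note add = subspace_add[OF subspace_E_den] and scale = subspace_scale[OF subspace_E_den]
  show den_num: "x * y \<in> E_den r (p + p') (q + q')"
    if x: "x \<in> E_den r p q" and y: "y \<in> E_num r p' q'" for x y p q p' q'
  proof -
    obtain u f where uf: "u \<in> Z (r - 1) (p + r - 1) (q - 1)" "f \<in> FG (p - 1) q" "x = d u + f"
      using x by (auto simp: E_den_def set_plus_def)
    obtain z g where zg: "z \<in> Z r p' q'" "g \<in> FG (p' - 1) q'" "y = z + g"
      using y by (auto simp: E_num_def set_plus_def)
    have "d u \<in> FG p q" using uf(1) d_Z_subset_Z[OF r] Z_subset_FG by blast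
    then have 1: "d u * g \<in> FG (p + p' - 1) (q + q')"
      using FG_mult[of "d u" p q g "p' - 1" q'] zg by (simp add: algebra_simps)
    have 2: "f * y \<in> FG (p + p' - 1) (q + q')"
      using FG_mult[of f "p - 1" q y p' q'] uf y E_num_subset_FG by (fastforce simp: algebra_simps)
    have 3: "d u * z \<in> E_den r (p + p') (q + q')"
    proof (cases "r = 0")
      case True
      then have "u = 0" using uf(1) by (simp add: Z_def)
      then show ?thesis using subspace_0[OF subspace_E_den] by (simp add: d_0)
    next
      case False
      then have r1: "r \<ge> 1" using r by simp
      have u: "u \<in> FG (p + r - 1) (q - 1)" "d u \<in> FG p q" using uf(1) r1 by (auto simp: Z_def)
      have z: "z \<in> FG p' q'" "d z \<in> FG (p' - r) (q' + 1)" using zg(1) r1 by (auto simp: Z_def)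
      have udz: "u * d z \<in> FG (p + p' - 1) (q + q')"
        using FG_mult[OF u(1) z(2)] by (simp add: algebra_simps)
      have eq: "d (u * z) = d u * z + ((-1) powi (q - 1)) *s (u * d z)"
        using u d_Leibniz by (auto simp: FG_def)
      have "d u * z \<in> FG (p + p') (q + q')" using FG_mult[OF u(2) z(1)] .
      moreover have "((-1) powi (q - 1)) *s (u * d z) \<in> FG (p + p') (q + q')"
        using udz FG_mono[of "p + p' - 1" "p + p'"] by (intro subspace_scale[OF subspace_FG]) auto
      ultimately have "d (u * z) \<in> FG (p + p') (q + q')"
        unfolding eq by (rule subspace_add[OF subspace_FG])
      then have "u * z \<in> Z (r - 1) (p + p' + r - 1) (q + q' - 1)"
        using FG_mult[OF u(1) z(1)] r1 by (simp add: Z_def algebra_simps)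
      then have "d (u * z) \<in> E_den r (p + p') (q + q')" using d_Z_subset_E_den by blast
      moreover have "((-1) powi (q - 1)) *s (u * d z) \<in> E_den r (p + p') (q + q')"
        using scale udz FG_subset_E_den by blast
      ultimately have "d (u * z) - ((-1) powi (q - 1)) *s (u * d z) \<in> E_den r (p + p') (q + q')"
        by (rule subspace_diff[OF subspace_E_den])
      then show ?thesis unfolding eq by simp
    qed
    have "d u * z + (d u * g + f * y) \<in> E_den r (p + p') (q + q')"
      using 1 2 3 FG_subset_E_den by (intro add) auto
    then show ?thesis using uf zg by (simp add: algebra_simps)
  qed
  assume x: "x \<in> E_num r p q" and y: "y \<in> E_den r p' q'"
  have "x \<in> G q" "y \<in> G q'"
    using x y E_num_subset_FG E_den_subset_E_num[OF r] unfolding FG_def by blast+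
  then have "x * y = ((-1) powi (q * q')) *s (y * x)" by (rule graded_commute)
  moreover have "y * x \<in> E_den r (p' + p) (q' + q)" using den_num y x .
  ultimately show "x * y \<in> E_den r (p + p') (q + q')"
    using scale by (simp add: add.commute)
qed

lemma E_mult_coset:
  assumes x: "x \<in> E_num r p q" and y: "y \<in> E_num r p' q'" and r: "r \<ge> 0"
  shows "E_mult r p q p' q' (x +o E_den r p q) (y +o E_den r p' q') =
    (x * y) +o E_den r (p + p') (q + q')"
    and "(x * y) +o E_den r (p + p') (q + q') \<in> carrier (E r (p + p') (q + q'))"
proof -
  let ?W = "E_den r (p + p') (q + q')"
  note add = subspace_add[OF subspace_E_den]
  show "E_mult r p q p' q' (x +o E_den r p q) (y +o E_den r p' q') = (x * y) +o ?W"
  proof (rule subset_antisym; rule subsetI)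
    fix c assume "c \<in> E_mult r p q p' q' (x +o E_den r p q) (y +o E_den r p' q')"
    then obtain v v' w where v: "v \<in> E_den r p q" "v' \<in> E_den r p' q'" "w \<in> ?W"
      and c: "c = (x + v) * (y + v') + w"
      by (auto simp: E_mult_def set_plus_def set_times_def elt_set_plus_def)
    have "c = x * y + (x * v' + v * y + v * v' + w)" using c by (simp add: algebra_simps)
    moreover have "x * v' + v * y + v * v' + w \<in> ?W"
      using E_den_mult(1)[OF r v(1) y] E_den_mult(2)[OF r x v(2)] v(3)
        E_den_mult(1)[OF r v(1) subsetD[OF E_den_subset_E_num[OF r] v(2)]]
      by (intro add)
    ultimately show "c \<in> (x * y) +o ?W" unfolding elt_set_plus_def by blast
  next
    fix c assume "c \<in> (x * y) +o ?W"
    then obtain w where "w \<in> ?W" "c = x * y + w" by (auto simp: elt_set_plus_def)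
    moreover have "x \<in> x +o E_den r p q" "y \<in> y +o E_den r p' q'"
      using subspace_0[OF subspace_E_den] by (force simp: elt_set_plus_def)+
    ultimately show "c \<in> E_mult r p q p' q' (x +o E_den r p q) (y +o E_den r p' q')"
      unfolding E_mult_def by blast
  qed
  show "(x * y) +o ?W \<in> carrier (E r (p + p') (q + q'))"
    using E_num_mult[OF x y r] by (auto simp: E_def quotient_space_def)
qed

end

end

theory Submission
  imports Defs
begin

text \<open>The proof is by induction on \<open>r\<close>. Vanishing in the range \<open>p > m\<close> or \<open>q > n\<close> is inherited by
  homology. No nonzero differential enters or leaves \<open>E\<^sub>r\<^sup>m\<^sup>,\<^sup>n\<close>: its source is \<open>E\<^sub>r\<^sup>m\<^sup>+\<^sup>r\<^sup>,\<^sup>n\<^sup>-\<^sup>1\<close> or its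
  target is \<open>E\<^sub>r\<^sup>m\<^sup>-\<^sup>r\<^sup>,\<^sup>n\<^sup>+\<^sup>1\<close>, both of which are zero. So this line is the same on the next page
  (\<open>E_unchanged\<close>).

  For the pairing, the Leibniz rule and the vanishing of \<open>E\<^sub>r\<^sup>m\<^sup>+\<^sup>r\<^sup>,\<^sup>n\<^sup>-\<^sup>1\<close> say that \<open>d\<^sub>r\<close> is adjoint to itself
  up to sign: \<open>d\<^sub>r(y) w = \<plusminus> y d\<^sub>r(w)\<close> whenever the two products lie in \<open>E\<^sub>r\<^sup>m\<^sup>,\<^sup>n\<close>. Hence a class \<open>w\<close>
  orthogonal to all boundaries satisfies \<open>y d\<^sub>r(w) = 0\<close> for all \<open>y\<close>, and nondegeneracy on page \<open>r\<close>
  makes \<open>w\<close> a cycle. A class \<open>x\<close> orthogonal to all cycles is therefore orthogonal to everything that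
  is orthogonal to the boundaries. The spaces are finite-dimensional and the pairing takes values
  in a line, so \<open>x\<close> is itself a boundary (\<open>mem_span_plus_radical\<close>). That is nondegeneracy on
  page \<open>r + 1\<close> (\<open>left_nondegenerate_next_page\<close>).

  The argument is carried out on representatives in \<open>Z\<close>, with equations modulo \<open>E_den\<close>: the cycle \<open>w\<close>
  above is one only on page \<open>r\<close>, and becomes an element of \<open>Z (r + 1)\<close> after a correction
  of lower filtration (\<open>cycle_lifts_to_next_page\<close>), which changes no class.\<close>

section \<open>Orthogonality with values in a line\<close>

text \<open>The double orthogonal of a finitely generated space \<open>span S\<close> is \<open>span S\<close> plus the left radical,
  for a pairing with values in \<open>N\<close> modulo \<open>D\<close>, where this quotient is at most a line. It is
  the fact that a functional vanishing on the common kernel of finitely many functionals is a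
  combination of them, read through \<open>v \<mapsto> \<beta> v\<close>. Working modulo \<open>D\<close> and up to the radical
  avoids passing to quotients and comparing dimensions.\<close>

lemma (in vector_space) mem_span_plus_radical:
  fixes \<beta> :: "'b \<Rightarrow> 'b \<Rightarrow> 'b"
  assumes bilinear: "\<And>v v' w. \<beta> (v + v') w = \<beta> v w + \<beta> v' w" "\<And>c v w. \<beta> (scale c v) w = scale c (\<beta> v w)"
      "\<And>v w w'. \<beta> v (w + w') = \<beta> v w + \<beta> v w'" "\<And>c v w. \<beta> v (scale c w) = scale c (\<beta> v w)"
    and subspaces: "subspace V" "subspace W" "subspace D"
    and val: "\<And>v w. v \<in> V \<Longrightarrow> w \<in> W \<Longrightarrow> \<beta> v w \<in> N"
    and line: "\<And>x y. x \<in> N \<Longrightarrow> y \<in> N \<Longrightarrow> y \<notin> D \<Longrightarrow> \<exists>c. x - scale c y \<in> D"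
    and S: "finite S" "S \<subseteq> V" and v: "v \<in> V"
    and perp: "\<And>w. w \<in> W \<Longrightarrow> (\<And>s. s \<in> S \<Longrightarrow> \<beta> s w \<in> D) \<Longrightarrow> \<beta> v w \<in> D"
  shows "\<exists>s\<in>span S. \<forall>w\<in>W. \<beta> (v - s) w \<in> D"
  using S v perp
proof (induction S arbitrary: v rule: finite_induct)
  case empty
  then show ?case by (intro bexI[of _ 0]) auto
next
  case (insert b S)
  have diff_left: "\<beta> (u - u') w = \<beta> u w - \<beta> u' w" for u u' w
    using bilinear(1)[of "u - u'" u' w] by (simp add: algebra_simps)
  have diff_right: "\<beta> u (w - w') = \<beta> u w - \<beta> u w'" for u w w'
    using bilinear(3)[of u "w - w'" w'] by (simp add: algebra_simps)
  \<comment> \<open>Either \<open>b\<close> puts no further condition on the orthogonal of \<open>S\<close>, or some \<open>w0\<close> in that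
    orthogonal is not orthogonal to \<open>b\<close>; then subtracting a multiple of \<open>b\<close> from \<open>v\<close> achieves
    orthogonality to \<open>w0\<close>, and the rest of the orthogonal of \<open>S\<close> is reached by adding multiples of \<open>w0\<close>
    to elements that are also orthogonal to \<open>b\<close>.\<close>
  show ?case
  proof (cases "\<forall>w\<in>W. (\<forall>s\<in>S. \<beta> s w \<in> D) \<longrightarrow> \<beta> b w \<in> D")
    case True
    then have "\<exists>s\<in>span S. \<forall>w\<in>W. \<beta> (v - s) w \<in> D"
      using insert.prems by (intro insert.IH) auto
    then show ?thesis using span_mono[of S "insert b S"] by blast
  next
    case False
    then obtain w0 where w0: "w0 \<in> W" "\<And>s. s \<in> S \<Longrightarrow> \<beta> s w0 \<in> D" "\<beta> b w0 \<notin> D"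
      by blast
    have b: "b \<in> V" using insert.prems by simp
    obtain c where c: "\<beta> v w0 - scale c (\<beta> b w0) \<in> D"
      using line[OF val[OF insert.prems(2) w0(1)] val[OF b w0(1)] w0(3)] by blast
    have "\<beta> (v - scale c b) w \<in> D" if w: "w \<in> W" and wS: "\<And>s. s \<in> S \<Longrightarrow> \<beta> s w \<in> D" for w
    proof -
      obtain e where e: "\<beta> b w - scale e (\<beta> b w0) \<in> D"
        using line[OF val[OF b w] val[OF b w0(1)] w0(3)] by blast
      have "\<beta> v (w - scale e w0) \<in> D"
      proof (rule insert.prems(3))
        show "w - scale e w0 \<in> W"
          using subspaces w w0 by (intro subspace_diff subspace_scale)
        show "\<beta> s (w - scale e w0) \<in> D" if "s \<in> insert b S" for s
          using that e wS w0(2) subspaces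
          by (auto simp: diff_right bilinear intro!: subspace_diff subspace_scale)
      qed
      then have "\<beta> v (w - scale e w0) + scale e (\<beta> v w0 - scale c (\<beta> b w0))
          - scale c (\<beta> b w - scale e (\<beta> b w0)) \<in> D"
        by (intro subspace_diff[OF subspaces(3)] subspace_add[OF subspaces(3)]
            subspace_scale[OF subspaces(3) c] subspace_scale[OF subspaces(3) e])
      then show ?thesis
        by (simp add: diff_left diff_right bilinear scale_right_diff_distrib mult.commute)
    qed
    moreover have "v - scale c b \<in> V"
      using subspaces b insert.prems by (intro subspace_diff subspace_scale)
    ultimately obtain s where s: "s \<in> span S" "\<forall>w\<in>W. \<beta> (v - scale c b - s) w \<in> D"
      using insert.IH[of "v - scale c b"] insert.prems by blast
    have "s \<in> span (insert b S)" using s(1) span_mono[of S "insert b S"] by blast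
    then have "scale c b + s \<in> span (insert b S)"
      by (simp add: span_add span_scale span_base)
    moreover have "v - (scale c b + s) = v - scale c b - s" by simp
    ultimately show ?thesis using s(2) by metis
  qed
qed

section \<open>Quotients of dimension one\<close>

context vector_space_with_quotients
begin

text \<open>The dimension is a least size of finite generating sets, an unspecified number unless there is
  one; finiteness is what makes an equation for the dimension informative.\<close>

lemma fin_dim_quotient_space:
  assumes U: "subspace U" and W: "subspace W"
    and B: "finite B" "B \<subseteq> U" "U \<subseteq> span B"
  shows "vectorspace.fin_dim class_ring (quotient_space U W)"
proof -
  interpret Q: vectorspace class_ring "quotient_space U W"
    by (rule vectorspace_quotient_space[OF U W])
  define C where "C = (\<lambda>x. x +o W) ` B"
  have C: "C \<subseteq> carrier (quotient_space U W)" using B by (auto simp: C_def quotient_space_def)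
  interpret S: submodule class_ring "Q.span C" "quotient_space U W"
    by (rule Q.span_is_submodule[OF C])
  have "x +o W \<in> Q.span C" if "x \<in> span B" for x
    using that
  proof (induction rule: span_induct_alt)
    case base
    have "0 +o W = \<zero>\<^bsub>quotient_space U W\<^esub>" by (simp add: quotient_space_def)
    then show ?case using S.zero_closed by metis
  next
    case (step c x y)
    have "x +o W \<in> Q.span C" using Q.in_own_span[OF C] step C_def by blast
    then have "scale c ` (x +o W) + W \<in> Q.span C"
      using S.smult_closed[of c "x +o W"] by (simp add: quotient_space_def)
    then have "scale c x +o W \<in> Q.span C" using coset_scale[OF W] by simp
    then show ?case
      using S.m_closed[of "scale c x +o W" "y +o W"] step coset_plus[OF W]
      by (simp add: quotient_space_def)
  qed
  then have "carrier (quotient_space U W) \<subseteq> Q.span C"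
    using B by (auto simp: quotient_space_def)
  then have "Q.span C = carrier (quotient_space U W)" using S.subset by blast
  moreover have "finite C" using B(1) by (simp add: C_def)
  ultimately show ?thesis unfolding Q.fin_dim_def using C by metis
qed

lemma quotient_space_dim_1:
  assumes U: "subspace U" and W: "subspace W"
    and fin: "vectorspace.fin_dim class_ring (quotient_space U W)"
    and dim: "vectorspace.dim class_ring (quotient_space U W) = 1"
    and x: "x \<in> U" and y: "y \<in> U" "y \<notin> W"
  shows "\<exists>c. x - scale c y \<in> W"
proof -
  interpret Q: vectorspace class_ring "quotient_space U W"
    by (rule vectorspace_quotient_space[OF U W])
  obtain A where A: "card A = 1" "A \<subseteq> carrier (quotient_space U W)"
    "Q.span A = carrier (quotient_space U W)"
    using LeastI_ex[of "\<lambda>n. \<exists>A. finite A \<and> card A = n \<and> A \<subseteq> carrier (quotient_space U W)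
      \<and> Q.span A = carrier (quotient_space U W)"] fin dim
    unfolding Q.fin_dim_def Q.dim_def by auto
  from A(1) obtain C where "A = {C}" by (auto simp: card_1_singleton_iff)
  with A(2) obtain x0 where x0: "A = {x0 +o W}" "x0 \<in> U" by (auto simp: quotient_space_def)
  have multiple: "\<exists>c. z - scale c x0 \<in> W" if "z \<in> U" for z
  proof -
    have "z +o W \<in> Q.span A" using that A by (auto simp: quotient_space_def)
    then obtain a where "Q.lincomb a A = z +o W"
      using Q.finite_in_span[of A "z +o W"] A x0 by auto
    moreover have "Q.lincomb a A = scale (a (x0 +o W)) x0 +o W"
      using A(2) coset_scale[OF W] Q.smult_closed[of "a (x0 +o W)" "x0 +o W"]
      by (simp add: Q.lincomb_def x0(1)) (simp add: quotient_space_def)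
    ultimately show ?thesis using coset_eq_iff[OF W] by metis
  qed
  obtain a b where a: "x - scale a x0 \<in> W" and b: "y - scale b x0 \<in> W"
    using multiple x y(1) by blast
  have "b \<noteq> 0" using b y(2) by auto
  then have "x - scale (a / b) y = (x - scale a x0) - scale (a / b) (y - scale b x0)"
    by (simp add: scale_right_diff_distrib)
  then show ?thesis using a b W by (metis subspace_diff subspace_scale)
qed

end

section \<open>Pages of the spectral sequence in terms of representatives\<close>

context filtered_dga
begin

lemma finite_spanning_subset: obtains B where "finite B" "B \<subseteq> U" "U \<subseteq> span B"
proof -
  obtain T where T: "finite T" "span T = UNIV" using finite_dimensional by blast
  obtain B where "B \<subseteq> U" "independent B" "U \<subseteq> span B"
    using maximal_independent_subset[of U] by metis
  then show ?thesis using that independent_span_bound[OF T(1), of B] T(2) by auto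
qed

lemma mem_Z_iff: "r \<ge> 0 \<Longrightarrow> x \<in> Z r p q \<longleftrightarrow> x \<in> FG p q \<and> d x \<in> FG (p - r) (q + 1)"
  by (simp add: Z_def)

lemma Z_subset_G: "Z r p q \<subseteq> G q"
  using Z_subset_FG by (auto simp: FG_def)

lemma FG_neg: "p < 0 \<or> q < 0 \<Longrightarrow> FG p q = {0}"
  using filtration_neg grading_neg subspace_0[OF subspace_F] subspace_0[OF subspace_G]
  by (auto simp: FG_def)

lemma d_diff: "d (x - y) = d x - d y"
  using d_add[of "x - y" y] by (simp add: algebra_simps)

lemma mult_commute_mem:
  assumes "x \<in> G q" "y \<in> G q'" "subspace D"
  shows "x * y \<in> D \<longleftrightarrow> y * x \<in> D"
  using graded_commute[OF assms(1,2)] graded_commute[OF assms(2,1)] subspace_scale[OF assms(3)]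
  by metis

lemma E_numE:
  assumes "x \<in> E_num r p q"
  obtains z where "z \<in> Z r p q" "x - z \<in> E_den r p q"
  using assms FG_subset_E_den unfolding E_num_def set_plus_def by fastforce

text \<open>The summand \<open>FG (p - 1) q\<close> of the numerator is part of the denominator, so representatives
  can be taken in \<open>Z\<close>, where there is control over the differential.\<close>

lemma carrier_E: "carrier (E r p q) = (\<lambda>z. z +o E_den r p q) ` Z r p q"
proof -
  have "\<exists>z\<in>Z r p q. x +o E_den r p q = z +o E_den r p q" if "x \<in> E_num r p q" for x
    using E_numE[OF that] coset_eq_iff[OF subspace_E_den] by metis
  then show ?thesis
    using Z_subset_E_num unfolding E_def quotient_space_def by (fastforce simp: image_iff)
qed

lemma zero_E: "\<zero>\<^bsub>E r p q\<^esub> = E_den r p q"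
  by (simp add: E_def quotient_space_def)

lemma coset_E_den_eq_zero_iff: "x +o E_den r p q = E_den r p q \<longleftrightarrow> x \<in> E_den r p q"
  using coset_eq_iff[OF subspace_E_den, of x r p q 0] by simp

lemma E_eq_zero_iff: "carrier (E r p q) = {\<zero>\<^bsub>E r p q\<^esub>} \<longleftrightarrow> Z r p q \<subseteq> E_den r p q"
  using subspace_0[OF subspace_Z, of r p q] coset_E_den_eq_zero_iff[of _ r p q]
  unfolding carrier_E zero_E by (auto simp: image_iff)

text \<open>By graded commutativity the right radical is a left radical with the two bidegrees swapped.
  One condition, required in all bidegrees, thus covers both sides.\<close>

definition left_nondegenerate :: "int \<Rightarrow> int \<Rightarrow> int \<Rightarrow> int \<Rightarrow> int \<Rightarrow> bool" where
  "left_nondegenerate r p q p' q' \<longleftrightarrow>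
     (\<forall>x\<in>Z r p q. (\<forall>y\<in>Z r p' q'. x * y \<in> E_den r (p + p') (q + q')) \<longrightarrow> x \<in> E_den r p q)"

lemma E_pairing_nondegenerate_iff:
  assumes r: "r \<ge> 0"
  shows "E_pairing_nondegenerate r p q p' q' \<longleftrightarrow>
    left_nondegenerate r p q p' q' \<and> left_nondegenerate r p' q' p q"
proof -
  have mult: "E_mult r p q p' q' (x +o E_den r p q) (y +o E_den r p' q') = E_den r (p + p') (q + q')
      \<longleftrightarrow> x * y \<in> E_den r (p + p') (q + q')" if "x \<in> Z r p q" "y \<in> Z r p' q'" for x y
    using E_mult_coset(1)[of x r p q y p' q'] that Z_subset_E_num r coset_E_den_eq_zero_iff by blast
  have commute: "y * x \<in> E_den r (p' + p) (q' + q) \<longleftrightarrow> x * y \<in> E_den r (p + p') (q + q')"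
    if "x \<in> Z r p q" "y \<in> Z r p' q'" for x y
  proof -
    have "x \<in> G q" "y \<in> G q'" using that Z_subset_G by auto
    then show ?thesis using mult_commute_mem[OF _ _ subspace_E_den] by (simp add: add.commute)
  qed
  show ?thesis
    unfolding E_pairing_nondegenerate_def carrier_E zero_E left_nondegenerate_def
    by (simp add: mult commute coset_E_den_eq_zero_iff cong: ball_cong)
qed

section \<open>Passage to the next page\<close>

lemma Z_mono: "0 \<le> r \<Longrightarrow> r \<le> r' \<Longrightarrow> Z r' p q \<subseteq> Z r p q"
  using FG_mono[of "p - r'" "p - r" "q + 1"] by (auto simp: mem_Z_iff)

lemma E_den_mono:
  assumes r: "r \<ge> 1"
  shows "E_den r p q \<subseteq> E_den (r + 1) p q"
proof -
  have "Z (r - 1) (p + r - 1) (q - 1) \<subseteq> Z r (p + r) (q - 1)"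
    using r FG_mono[of "p + r - 1" "p + r" "q - 1"] by (auto simp: mem_Z_iff)
  then show ?thesis unfolding E_den_def by (intro set_plus_mono2) auto
qed

text \<open>If \<open>d\<^sub>r\<close> kills the class of \<open>z\<close>, then \<open>d z\<close> is, up to lower filtration, the differential of an
  element \<open>u\<close> of filtration \<open>p - 1\<close>. Subtracting \<open>u\<close> does not change the class of \<open>z\<close>.\<close>

lemma cycle_lifts_to_next_page:
  assumes r: "r \<ge> 1" and z: "z \<in> Z r p q" and dz: "d z \<in> E_den r (p - r) (q + 1)"
  obtains u where "u \<in> FG (p - 1) q" "z - u \<in> Z (r + 1) p q"
proof -
  obtain u f where u: "u \<in> Z (r - 1) (p - 1) q" and f: "f \<in> FG (p - r - 1) (q + 1)"
    and eq: "d z = d u + f"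
    using dz by (auto simp: E_den_def set_plus_def)
  have "u \<in> FG p q" using u Z_subset_FG FG_mono[of "p - 1" p q] by fastforce
  then have "z - u \<in> FG p q" using z Z_subset_FG by (blast intro: subspace_diff[OF subspace_FG])
  moreover have "d (z - u) \<in> FG (p - (r + 1)) (q + 1)"
    using f eq by (simp add: d_diff algebra_simps)
  ultimately have "z - u \<in> Z (r + 1) p q" using r by (simp add: mem_Z_iff)
  then show ?thesis using that u Z_subset_FG by blast
qed

text \<open>The differential out of a zero space is zero. In terms of representatives, \<open>z\<close> is a boundary
  plus some \<open>f\<close> of lower filtration; since \<open>d f = d z\<close>, the element \<open>f\<close> is among those whose
  differentials are divided out on page \<open>r\<close>.\<close>

lemma d_into_E_den_of_E_eq_zero:
  assumes r: "r \<ge> 1" and van: "Z r (p + r) (q - 1) \<subseteq> E_den r (p + r) (q - 1)"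
  shows "d ` Z r (p + r) (q - 1) \<subseteq> E_den r p q"
proof
  fix x assume "x \<in> d ` Z r (p + r) (q - 1)"
  then obtain z where z: "z \<in> Z r (p + r) (q - 1)" "x = d z" by blast
  then obtain u f where f: "f \<in> FG (p + r - 1) (q - 1)" and eq: "z = d u + f"
    using van by (auto simp: E_den_def set_plus_def)
  have "d f = d z" using eq by (simp add: d_add d_d)
  moreover have "d z \<in> FG p q" using z r by (simp add: mem_Z_iff)
  ultimately have "f \<in> Z (r - 1) (p + r - 1) (q - 1)" using f r by (simp add: mem_Z_iff)
  then show "x \<in> E_den r p q" using \<open>d f = d z\<close> z d_Z_subset_E_den by force
qed

text \<open>Not only an isomorphism but an equality of numerators and denominators, so that \<open>E (r + 1) p q\<close>
  and \<open>E r p q\<close> are the same record and the dimension carries over by rewriting.\<close>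

lemma E_unchanged:
  assumes r: "r \<ge> 1"
    and source: "Z r (p + r) (q - 1) \<subseteq> E_den r (p + r) (q - 1)"
    and target: "Z r (p - r) (q + 1) \<subseteq> E_den r (p - r) (q + 1)"
  shows "E_num (r + 1) p q = E_num r p q" "E_den (r + 1) p q = E_den r p q"
proof -
  show "E_den (r + 1) p q = E_den r p q"
  proof
    show "E_den (r + 1) p q \<subseteq> E_den r p q"
      using d_into_E_den_of_E_eq_zero[OF r source] FG_subset_E_den[of p q r]
        subspace_add[OF subspace_E_den, of _ r p q]
      unfolding E_den_def[of "r + 1"] by (auto simp: set_plus_def)
  qed (rule E_den_mono[OF r])
  show "E_num (r + 1) p q = E_num r p q"
  proof
    show "E_num (r + 1) p q \<subseteq> E_num r p q"
      unfolding E_num_def using Z_mono[of r "r + 1"] r by (intro set_plus_mono2) auto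
    have "z \<in> E_num (r + 1) p q" if z: "z \<in> Z r p q" for z
    proof -
      have "d z \<in> Z r (p - r) (q + 1)"
        using z r subspace_0[OF subspace_FG] by (auto simp: mem_Z_iff d_d)
      then obtain u where u: "u \<in> FG (p - 1) q" "z - u \<in> Z (r + 1) p q"
        using cycle_lifts_to_next_page[OF r z] target by blast
      then have "(z - u) + u \<in> E_num (r + 1) p q" unfolding E_num_def by blast
      then show ?thesis by simp
    qed
    then show "E_num r p q \<subseteq> E_num (r + 1) p q"
      using FG_subset_E_num[of p q "r + 1"] subspace_add[OF subspace_E_num, of _ "r + 1" p q]
      unfolding E_num_def[of r] by (auto simp: set_plus_def)
  qed
qed

text \<open>The orthogonal of the boundaries consists of cycles, because \<open>d\<^sub>r\<close> is self-adjoint up to sign.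
  So an element orthogonal to the cycles is in the double orthogonal of the boundaries. Bidegrees
  range over all integers: \<open>d\<^sub>r\<close> may lead out of the rectangle \<open>0 \<le> p \<le> m\<close>, \<open>0 \<le> q \<le> n\<close>, where
  nondegeneracy is the vanishing of the page.\<close>

lemma left_nondegenerate_next_page:
  assumes r: "r \<ge> 1"
    and van: "\<And>p q. p > m \<or> q > n \<Longrightarrow> Z r p q \<subseteq> E_den r p q"
    and line: "\<And>x y. x \<in> E_num r m n \<Longrightarrow> y \<in> E_num r m n \<Longrightarrow> y \<notin> E_den r m n \<Longrightarrow>
      \<exists>c. x - c *s y \<in> E_den r m n"
    and nondeg: "\<And>p q. left_nondegenerate r p q (m - p) (n - q)"
  shows "left_nondegenerate (r + 1) p q (m - p) (n - q)"
  unfolding left_nondegenerate_def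
proof (intro ballI impI)
  fix x assume x: "x \<in> Z (r + 1) p q"
    and "\<forall>y\<in>Z (r + 1) (m - p) (n - q). x * y \<in> E_den (r + 1) (p + (m - p)) (q + (n - q))"
  then have x_perp: "x * y \<in> E_den r m n" if "y \<in> Z (r + 1) (m - p) (n - q)" for y
    using that E_unchanged(2)[OF r van van, of m n] r by simp
  have x_Z: "x \<in> Z r p q" using x Z_mono[of r "r + 1"] r by auto
  define S where "S = d ` Z r (p + r) (q - 1)"
  obtain B where B: "finite B" "B \<subseteq> S" "S \<subseteq> span B"
    using finite_spanning_subset by blast
  have S_Z: "S \<subseteq> Z r p q"
    unfolding S_def using d_Z_subset_Z[of "r + 1" p q] Z_mono[of r "r + 1" p q] r by auto
  have "\<exists>s\<in>span B. \<forall>w\<in>Z r (m - p) (n - q). (x - s) * w \<in> E_den r m n"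
  proof (rule mem_span_plus_radical[where V = "Z r p q" and N = "E_num r m n"])
    fix w assume w: "w \<in> Z r (m - p) (n - q)" and B_perp: "\<And>s. s \<in> B \<Longrightarrow> s * w \<in> E_den r m n"
    \<comment> \<open>The element \<open>w\<close> is orthogonal to the boundaries; the next steps show that it is a cycle on
      page \<open>r\<close>, and then replace it by a representative \<open>w - u\<close> to which the orthogonality of \<open>x\<close> applies.\<close>
    have S_perp: "s * w \<in> E_den r m n" if "s \<in> S" for s
    proof -
      have "s \<in> span B" using that B by blast
      then show ?thesis
        by (induction rule: span_induct_alt)
          (simp_all add: B_perp distrib_right scale_mult_left subspace_0[OF subspace_E_den]
            subspace_add[OF subspace_E_den] subspace_scale[OF subspace_E_den])
    qed
    have dw: "d w \<in> Z r (m - p - r) (n - q + 1)"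
      using w r subspace_0[OF subspace_FG] by (auto simp: mem_Z_iff d_d)
    have "y * d w \<in> E_den r m n" if y: "y \<in> Z r (p + r) (q - 1)" for y
    proof -
      have "y * w \<in> Z r (m + r) (n - 1)"
        using Z_mult[OF y w] r by (simp add: algebra_simps)
      then have "d (y * w) \<in> E_den r m n"
        using d_into_E_den_of_E_eq_zero[OF r van, of m n] r by auto
      moreover have "d y * w \<in> E_den r m n" using S_perp y S_def by blast
      moreover have "d (y * w) = d y * w + ((-1) powi (q - 1)) *s (y * d w)"
        using y Z_subset_G by (intro d_Leibniz) auto
      ultimately have "((-1) powi (q - 1)) *s (y * d w) \<in> E_den r m n"
        using subspace_diff[OF subspace_E_den] by (metis add_diff_cancel_left')
      then have "inverse ((-1) powi (q - 1)) *s ((-1) powi (q - 1)) *s (y * d w) \<in> E_den r m n"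
        by (rule subspace_scale[OF subspace_E_den])
      then show ?thesis by simp
    qed
    then have "d w * y \<in> E_den r m n" if "y \<in> Z r (p + r) (q - 1)" for y
      using that dw Z_subset_G mult_commute_mem[OF _ _ subspace_E_den] by blast
    then have "d w \<in> E_den r (m - p - r) (n - q + 1)"
      using dw nondeg[of "m - p - r" "n - q + 1"]
      unfolding left_nondegenerate_def by (simp add: algebra_simps)
    then obtain u where u: "u \<in> FG (m - p - 1) (n - q)" "w - u \<in> Z (r + 1) (m - p) (n - q)"
      using cycle_lifts_to_next_page[OF r w] by blast
    have "x * u \<in> FG (m - 1) n"
      using FG_mult[of x p q u "m - p - 1" "n - q"] x Z_subset_FG u by auto
    then have "x * (w - u) + x * u \<in> E_den r m n"
      using x_perp[OF u(2)] FG_subset_E_den by (blast intro: subspace_add[OF subspace_E_den])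
    then show "x * w \<in> E_den r m n" by (simp add: algebra_simps)
  next
    show "v * w \<in> E_num r m n" if "v \<in> Z r p q" "w \<in> Z r (m - p) (n - q)" for v w
      using Z_mult[OF that] r Z_subset_E_num by auto
  qed (use B S_Z x_Z line in \<open>auto simp: distrib_left distrib_right scale_mult_left scale_mult_right
      subspace_Z subspace_E_den\<close>)
  then obtain s where s: "s \<in> span B" "\<And>w. w \<in> Z r (m - p) (n - q) \<Longrightarrow> (x - s) * w \<in> E_den r m n"
    by blast
  have "span B \<subseteq> S"
    using B(2) unfolding S_def by (intro span_minimal subspace_d_image subspace_Z) auto
  then have sS: "s \<in> S" using s by blast
  then have "x - s \<in> Z r p q" using x_Z S_Z by (blast intro: subspace_diff[OF subspace_Z])
  then have "x - s \<in> E_den r p q"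
    using nondeg[of p q] s(2) unfolding left_nondegenerate_def by simp
  then have "x - s \<in> E_den (r + 1) p q" using E_den_mono[OF r] by blast
  moreover have "s \<in> E_den (r + 1) p q"
    using sS d_Z_subset_E_den[of "r + 1" p q] by (auto simp: S_def)
  ultimately have "x - s + s \<in> E_den (r + 1) p q" by (rule subspace_add[OF subspace_E_den])
  then show "x \<in> E_den (r + 1) p q" by simp
qed

lemma Z_subset_E_den_neg: "p < 0 \<or> q < 0 \<Longrightarrow> Z r p q \<subseteq> E_den r p q"
  using Z_subset_FG[of r p q] FG_neg[of p q] subspace_0[OF subspace_E_den] by auto

text \<open>The induction invariant: the three properties, with the bidegrees in the first and the third
  ranging over all integers, as the inductive step requires.\<close>

definition duality_page :: "int \<Rightarrow> int \<Rightarrow> int \<Rightarrow> bool" where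
  "duality_page m n r \<longleftrightarrow>
     (\<forall>p q. p > m \<or> q > n \<longrightarrow> Z r p q \<subseteq> E_den r p q) \<and>
     vectorspace.dim class_ring (E r m n) = 1 \<and>
     (\<forall>p q. left_nondegenerate r p q (m - p) (n - q))"

lemma duality_page_iff:
  assumes r: "r \<ge> 0"
  shows "duality_page m n r \<longleftrightarrow>
    (\<forall>p\<ge>0. \<forall>q\<ge>0. p > m \<or> q > n \<longrightarrow> carrier (E r p q) = {\<zero>\<^bsub>E r p q\<^esub>}) \<and>
    vectorspace.dim class_ring (E r m n) = 1 \<and>
    (\<forall>p q. 0 \<le> p \<and> p \<le> m \<and> 0 \<le> q \<and> q \<le> n \<longrightarrow>
       E_pairing_nondegenerate r p q (m - p) (n - q))"
    (is "_ \<longleftrightarrow> ?van \<and> ?dim \<and> ?nondeg")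
proof
  assume D: "duality_page m n r"
  have "left_nondegenerate r (m - p) (n - q) p q" for p q
  proof -
    have "left_nondegenerate r (m - p) (n - q) (m - (m - p)) (n - (n - q))"
      using D unfolding duality_page_def by blast
    then show ?thesis by simp
  qed
  then show "?van \<and> ?dim \<and> ?nondeg"
    using D by (simp add: duality_page_def E_eq_zero_iff E_pairing_nondegenerate_iff[OF r])
next
  assume H: "?van \<and> ?dim \<and> ?nondeg"
  have van: "Z r p q \<subseteq> E_den r p q" if "p > m \<or> q > n" for p q
    using H that Z_subset_E_den_neg[of p q r] unfolding E_eq_zero_iff by (meson not_less)
  have "left_nondegenerate r p q (m - p) (n - q)" for p q
  proof (cases "0 \<le> p \<and> p \<le> m \<and> 0 \<le> q \<and> q \<le> n")
    case True
    then show ?thesis using H E_pairing_nondegenerate_iff[OF r] by blast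
  next
    case False
    then have "Z r p q \<subseteq> E_den r p q"
      using van[of p q] Z_subset_E_den_neg[of p q r] by (meson not_less)
    then show ?thesis unfolding left_nondegenerate_def by blast
  qed
  then show "duality_page m n r" using H van unfolding duality_page_def by blast
qed

lemma duality_page_next:
  assumes r: "r \<ge> 1" and D: "duality_page m n r"
  shows "duality_page m n (r + 1)"
proof -
  have van: "Z r p q \<subseteq> E_den r p q" if "p > m \<or> q > n" for p q
    using D that unfolding duality_page_def by blast
  have dim: "vectorspace.dim class_ring (E r m n) = 1"
    using D unfolding duality_page_def by blast
  obtain B where "finite B" "B \<subseteq> E_num r m n" "E_num r m n \<subseteq> span B"
    using finite_spanning_subset by blast
  then have "vectorspace.fin_dim class_ring (E r m n)"
    unfolding E_def by (intro fin_dim_quotient_space subspace_E_num subspace_E_den)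
  then have line: "\<exists>c. x - c *s y \<in> E_den r m n"
    if "x \<in> E_num r m n" "y \<in> E_num r m n" "y \<notin> E_den r m n" for x y
    using quotient_space_dim_1[OF subspace_E_num subspace_E_den] dim that unfolding E_def by blast
  have "Z (r + 1) p q \<subseteq> E_den (r + 1) p q" if "p > m \<or> q > n" for p q
    using van[OF that] Z_mono[of r "r + 1" p q] E_den_mono[OF r, of p q] r by auto
  moreover have "E (r + 1) m n = E r m n"
    using E_unchanged[OF r van van, of m n] r by (simp add: E_def)
  moreover have "left_nondegenerate (r + 1) p q (m - p) (n - q)" for p q
    using D van line unfolding duality_page_def by (intro left_nondegenerate_next_page[OF r]) auto
  ultimately show ?thesis using dim unfolding duality_page_def by simp
qed

end

theorem lemma2p5:
  fixes scale :: "'f::field \<Rightarrow> 'a::ring \<Rightarrow> 'a"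
    and G F :: "int \<Rightarrow> 'a set" and d :: "'a \<Rightarrow> 'a"
    and r0 m n :: int
  defines "E \<equiv> filtered_dga.E scale G F d"
  assumes "filtered_dga scale G F d"
    and "r0 \<ge> 1" and "m \<ge> 0" and "n \<ge> 0"
    and "\<forall>p\<ge>0. \<forall>q\<ge>0. p > m \<or> q > n \<longrightarrow> carrier (E r0 p q) = {\<zero>\<^bsub>E r0 p q\<^esub>}"
    and "vectorspace.dim class_ring (E r0 m n) = 1"
    and "\<forall>p q. 0 \<le> p \<and> p \<le> m \<and> 0 \<le> q \<and> q \<le> n \<longrightarrow>
           filtered_dga.E_pairing_nondegenerate scale G F d r0 p q (m - p) (n - q)"
  shows "\<forall>r\<ge>r0.
    (\<forall>p\<ge>0. \<forall>q\<ge>0. p > m \<or> q > n \<longrightarrow> carrier (E r p q) = {\<zero>\<^bsub>E r p q\<^esub>}) \<and>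
    vectorspace.dim class_ring (E r m n) = 1 \<and>
    (\<forall>p q. 0 \<le> p \<and> p \<le> m \<and> 0 \<le> q \<and> q \<le> n \<longrightarrow>
       filtered_dga.E_pairing_nondegenerate scale G F d r p q (m - p) (n - q))"
proof (intro allI impI)
  interpret A: filtered_dga scale G F d by fact
  fix r assume "r \<ge> r0"
  then have "A.duality_page m n r"
  proof (induction r rule: int_ge_induct)
    case base
    then show ?case using assms A.duality_page_iff[of r0 m n] by simp
  next
    case (step r)
    then show ?case using A.duality_page_next assms by simp
  qed
  then show "(\<forall>p\<ge>0. \<forall>q\<ge>0. p > m \<or> q > n \<longrightarrow> carrier (E r p q) = {\<zero>\<^bsub>E r p q\<^esub>}) \<and>
    vectorspace.dim class_ring (E r m n) = 1 \<and>
    (\<forall>p q. 0 \<le> p \<and> p \<le> m \<and> 0 \<le> q \<and> q \<le> n \<longrightarrow>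
       filtered_dga.E_pairing_nondegenerate scale G F d r p q (m - p) (n - q))"
    using A.duality_page_iff[of r m n] \<open>r \<ge> r0\<close> \<open>r0 \<ge> 1\<close> by (simp add: E_def)
qed

end
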